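(* Every primitive Pythagorean triple $(x,y,z)$ can be expressed in the following two ways: there exist integers $p_1,q_1$ with $$x=p_1q_1-q_1^2,\quad y=p_1q_1-\frac{p_1^2}{2},\quad z=\frac{p_1^2}{2}+q_1^2-p_1q_1,$$ and there exist integers $p_2,q_2$ with $$x=p_2q_2+q_2^2,\quad y=p_2q_2+\frac{p_2^2}{2},\quad z=\frac{p_2^2}{2}+q_2^2+p_2q_2.$$
   Context: A primitive Pythagorean triple is a triple $(x,y,z)$ of pairwise coprime natural (positive) numbers satisfying $x^2+y^2=z^2$, with the convention that $x$ is odd (so that $y$ is even and $z$ is odd). *)

theory Defs
  imports Complex_Main
begin

text \<open>Exactly one of the two legs of a primitive triple is even; the legs are ordered so that
  the first one is odd.\<close>

definition primitive_pythagorean_triple :: "nat \<Rightarrow> nat \<Rightarrow> nat \<Rightarrow> bool" where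
  "primitive_pythagorean_triple x y z \<longleftrightarrow>
     x > 0 \<and> y > 0 \<and> z > 0 \<and>
     coprime x y \<and> coprime x z \<and> coprime y z \<and>
     x\<^sup>2 + y\<^sup>2 = z\<^sup>2 \<and> odd x"

end

theory Submission
  imports Defs "HOL-Computational_Algebra.Nth_Powers"
begin

text \<open>
  The factors of \<open>x\<^sup>2 = (z - y) (z + y)\<close> are coprime, since both are odd and any common divisor
  divides \<open>2 y\<close> and \<open>2 z\<close>. Hence \<open>z - y = a\<^sup>2\<close> and \<open>z + y = b\<^sup>2\<close> with \<open>a b = x\<close>, and the
  parameters are \<open>p\<^sub>1 = a + b\<close>, \<open>q\<^sub>1 = b\<close> and \<open>p\<^sub>2 = b - a\<close>, \<open>q\<^sub>2 = a\<close>.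
\<close>

lemma primitive_pythagorean_triple_squares:
  assumes "primitive_pythagorean_triple x y z"
  obtains a b :: nat where "z = y + a\<^sup>2" "z + y = b\<^sup>2" "x = a * b"
proof -
  have cop: "coprime y z" and eq: "x\<^sup>2 + y\<^sup>2 = z\<^sup>2" and "odd x"
    using assms by (auto simp: primitive_pythagorean_triple_def)
  have "y\<^sup>2 \<le> z\<^sup>2"
    using eq by linarith
  then have "y \<le> z"
    by (simp add: power2_nat_le_eq_le)
  \<comment> \<open>Naming the difference \<open>d\<close> avoids truncated subtraction on
    \<open>nat\<close>.\<close>
  then obtain d where d: "z = y + d"
    using le_Suc_ex by blast
  have prod: "d * (z + y) = x\<^sup>2"
    using eq unfolding d by (simp add: power2_eq_square algebra_simps)
  have "odd (d * (z + y))"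
    using \<open>odd x\<close> unfolding prod by simp
  then have "odd d"
    by simp
  \<comment> \<open>Adding a multiple of one argument to the other preserves the gcd: coprimality of
    \<open>y\<close> and \<open>y + d\<close> passes to \<open>d\<close> and \<open>y\<close>. Since
    \<open>d\<close> is odd, the factor 2 is harmless, and adding \<open>d\<close> to
    \<open>2 * y\<close> then reaches \<open>z + y\<close>.\<close>
  have "coprime d y"
    using cop by (simp add: d coprime_iff_gcd_eq_1 gcd.commute)
  with \<open>odd d\<close> have "coprime d (2 * y)"
    by simp
  then have "coprime d (2 * y + d)"
    by (simp add: coprime_iff_gcd_eq_1 gcd.commute[of d])
  moreover have "z + y = 2 * y + d"
    by (simp add: d)
  ultimately have "coprime d (z + y)"
    by (simp only:)
  moreover have "is_nth_power 2 (d * (z + y))"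
    unfolding prod by simp
  \<comment> \<open>Coprime positive factors of a square are squares; \<open>d\<close> is positive
    because it is odd, and \<open>z + y\<close> exceeds or equals \<open>d\<close>.\<close>
  ultimately have "is_nth_power 2 d" "is_nth_power 2 (z + y)"
    using is_nth_power_mult_coprime_natD[of d "z + y" 2] \<open>odd d\<close> d by (auto intro: odd_pos)
  then obtain a b where ab: "d = a\<^sup>2" "z + y = b\<^sup>2"
    by (auto elim!: is_nth_powerE)
  have "x\<^sup>2 = (a * b)\<^sup>2"
    using prod by (simp add: ab power_mult_distrib)
  then have "x = a * b"
    by (simp add: power2_eq_iff_nonneg)
  with ab d show thesis
    using that by blast
qed

theorem theorem2:
  fixes x y z :: nat
  assumes "primitive_pythagorean_triple x y z"
  shows "(\<exists>p\<^sub>1 q\<^sub>1 :: int.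
            real x = of_int p\<^sub>1 * of_int q\<^sub>1 - (of_int q\<^sub>1)\<^sup>2 \<and>
            real y = of_int p\<^sub>1 * of_int q\<^sub>1 - (of_int p\<^sub>1)\<^sup>2 / 2 \<and>
            real z = (of_int p\<^sub>1)\<^sup>2 / 2 + (of_int q\<^sub>1)\<^sup>2 - of_int p\<^sub>1 * of_int q\<^sub>1) \<and>
         (\<exists>p\<^sub>2 q\<^sub>2 :: int.
            real x = of_int p\<^sub>2 * of_int q\<^sub>2 + (of_int q\<^sub>2)\<^sup>2 \<and>
            real y = of_int p\<^sub>2 * of_int q\<^sub>2 + (of_int p\<^sub>2)\<^sup>2 / 2 \<and>
            real z = (of_int p\<^sub>2)\<^sup>2 / 2 + (of_int q\<^sub>2)\<^sup>2 + of_int p\<^sub>2 * of_int q\<^sub>2)"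
proof -
  obtain a b where ab: "z = y + a\<^sup>2" "z + y = b\<^sup>2" "x = a * b"
    using assms by (rule primitive_pythagorean_triple_squares)
  have x: "real x = real a * real b"
    using ab(3) by simp
  have "real z = real y + (real a)\<^sup>2" "real z + real y = (real b)\<^sup>2"
    using ab(1,2) by (metis of_nat_add of_nat_power)+
  \<comment> \<open>Half the difference and half the sum of \<open>z + y\<close> and
    \<open>z - y\<close>.\<close>
  then have y: "real y = ((real b)\<^sup>2 - (real a)\<^sup>2) / 2"
    and z: "real z = ((real b)\<^sup>2 + (real a)\<^sup>2) / 2"
    by simp_all
  show ?thesis
  proof (intro conjI)
    show "\<exists>p\<^sub>1 q\<^sub>1 :: int.
        real x = of_int p\<^sub>1 * of_int q\<^sub>1 - (of_int q\<^sub>1)\<^sup>2 \<and>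
        real y = of_int p\<^sub>1 * of_int q\<^sub>1 - (of_int p\<^sub>1)\<^sup>2 / 2 \<and>
        real z = (of_int p\<^sub>1)\<^sup>2 / 2 + (of_int q\<^sub>1)\<^sup>2 - of_int p\<^sub>1 * of_int q\<^sub>1"
      \<comment> \<open>Here \<open>p\<^sub>1 - q\<^sub>1 = a\<close>, so \<open>x\<close> factors
        as \<open>q\<^sub>1 * (p\<^sub>1 - q\<^sub>1)\<close>.\<close>
      unfolding x y z
      by (intro exI[of _ "int a + int b"] exI[of _ "int b"])
         (simp add: power2_eq_square field_simps)
    show "\<exists>p\<^sub>2 q\<^sub>2 :: int.
        real x = of_int p\<^sub>2 * of_int q\<^sub>2 + (of_int q\<^sub>2)\<^sup>2 \<and>
        real y = of_int p\<^sub>2 * of_int q\<^sub>2 + (of_int p\<^sub>2)\<^sup>2 / 2 \<and>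
        real z = (of_int p\<^sub>2)\<^sup>2 / 2 + (of_int q\<^sub>2)\<^sup>2 + of_int p\<^sub>2 * of_int q\<^sub>2"
      \<comment> \<open>Now \<open>p\<^sub>2 + q\<^sub>2 = b\<close>, so \<open>x\<close> factors as
        \<open>q\<^sub>2 * (p\<^sub>2 + q\<^sub>2)\<close>; the difference \<open>b - a\<close> is
        formed in \<open>int\<close>, where it cannot truncate.\<close>
      unfolding x y z
      by (intro exI[of _ "int b - int a"] exI[of _ "int a"])
         (simp add: power2_eq_square field_simps)
  qed
qed

end
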